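(* Let $k>1$ be an odd integer and let $q,r>2$ be two coprime integers. Then either \[ \dim_{\mathbb{Q}} V_k(q)\geq \frac{\varphi(q)}{2}+1 \quad\text{or}\quad \dim_{\mathbb{Q}} V_k(r)\geq \frac{\varphi(r)}{2}+1 . \]
   Context: For real $0<x\leq 1$ and complex $s$ with $\Re(s)>1$, the Hurwitz zeta function is $\zeta(s,x)=\sum_{n=0}^\infty (n+x)^{-s}$. For integers $k>1$ and $q\geq 2$, the Chowla–Milnor space $V_k(q)$ is the $\mathbb{Q}$-vector subspace of $\mathbb{R}$ spanned by the real numbers $\zeta(k,a/q)$ with $1\leq a<q$ and $\gcd(a,q)=1$. Here $\varphi$ denotes Euler's totient function. *)

theory Defs
  imports "HOL-Analysis.Analysis" "HOL-Number_Theory.Totient"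
begin

(* The intended domain is 0 < x \<le> 1 and Re s > 1, where the series converges absolutely. *)
definition hurwitz_zeta :: "complex \<Rightarrow> real \<Rightarrow> complex" where
  "hurwitz_zeta s x = (\<Sum>n. (of_nat n + of_real x) powr (- s))"

lemma hurwitz_zeta_of_nat:
  fixes k :: nat and x :: real
  assumes "k > 1" "x > 0"
  shows "summable (\<lambda>n. 1 / (real n + x) ^ k)"
    and "hurwitz_zeta (of_nat k) x = of_real (\<Sum>n. 1 / (real n + x) ^ k)"
proof -
  show summ: "summable (\<lambda>n. 1 / (real n + x) ^ k)"
  proof (rule summable_comparison_test_ev)
    show "summable (\<lambda>n. inverse (real n ^ k))"
      using assms by (intro inverse_power_summable) auto
    show "eventually (\<lambda>n. norm (1 / (real n + x) ^ k) \<le> inverse (real n ^ k)) sequentially"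
      using eventually_gt_at_top[of 0]
    proof eventually_elim
      case (elim n)
      have "real n ^ k \<le> (real n + x) ^ k"
        using assms by (intro power_mono) auto
      then show ?case
        using elim assms by (simp add: inverse_eq_divide frac_le)
    qed
  qed
  have "(of_nat n + of_real x :: complex) powr (- of_nat k) = of_real (1 / (real n + x) ^ k)" for n
  proof -
    have "real n + x \<noteq> 0"
      using assms by (simp add: add_nonneg_eq_0_iff)
    then have "(of_real (real n + x) :: complex) \<noteq> 0"
      by (subst of_real_eq_0_iff)
    then show ?thesis
      by (simp add: powr_minus powr_nat' inverse_eq_divide)
  qed
  then show "hurwitz_zeta (of_nat k) x = of_real (\<Sum>n. 1 / (real n + x) ^ k)"
    unfolding hurwitz_zeta_def using summ by (simp only: suminf_of_real)
qed

global_interpretation rat_real: vector_space "\<lambda>(c :: rat) (x :: real). of_rat c * x"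
  by unfold_locales (simp_all add: algebra_simps of_rat_add of_rat_mult)

(* Re only moves the value from complex to real: by hurwitz_zeta_of_nat it is real. *)
definition chowla_milnor_space :: "nat \<Rightarrow> nat \<Rightarrow> real set" where
  "chowla_milnor_space k q =
     rat_real.span {Re (hurwitz_zeta (of_nat k) (real a / real q)) | a.
       1 \<le> a \<and> a < q \<and> coprime a q}"

end

theory Submission
  imports Defs "Jordan_Normal_Form.Char_Poly"
begin

text \<open>
  For odd \<open>k\<close>, differentiating the reflection formula of the digamma function shows that the
  differences \<open>\<zeta>(k, a/q) - \<zeta>(k, 1 - a/q)\<close> are \<open>(\<pi> i)^k\<close> times values
  \<open>H(w^a)\<close> of one rational polynomial at the powers of \<open>w = exp(2 \<pi> i/q)\<close>. Those with
  \<open>a < q/2\<close> coprime to \<open>q\<close> are linearly independent over the rationals: the Galois conjugates of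
  a rational relation are again relations, and their coefficient matrix is diagonally dominant
  because \<open>\<zeta>(k) - 1 < 1\<close>. Hence the dimension is at least \<open>\<phi>(q)/2\<close>. The space also contains
  \<open>\<zeta>(k)\<close>, so if the dimension is smaller than \<open>\<phi>(q)/2 + 1\<close>, then \<open>\<zeta>(k)/(\<pi> i)^k\<close>
  lies in the \<open>q\<close>-th cyclotomic field. If this happens for both \<open>q\<close> and \<open>r\<close>, some automorphism
  restricts to complex conjugation on the \<open>q\<close>-th and to the identity on the \<open>r\<close>-th cyclotomic
  field, so the number is real; but it is purely imaginary and nonzero.

  The conjugation of relations is obtained without irreducibility of cyclotomic polynomials, by
  Landau's argument with large primes.
\<close>

section \<open>Conjugation of rational relations between roots of unity\<close>

lemma power_mod_root_of_unity:
  fixes w :: "'a :: monoid_mult"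
  assumes "w ^ N = 1"
  shows "w ^ (m mod N) = w ^ m"
proof -
  have "w ^ m = w ^ (m mod N + N * (m div N))" by simp
  then show ?thesis using assms by (simp only: power_add power_mult) simp
qed

lemma power_cong_root_of_unity:
  fixes w :: "'a :: monoid_mult"
  assumes "w ^ N = 1" "[m = n] (mod N)"
  shows "w ^ m = w ^ n"
  using assms power_mod_root_of_unity[of w N] by (metis cong_def)

abbreviation ipoly :: "int poly \<Rightarrow> complex \<Rightarrow> complex" where
  "ipoly P w \<equiv> poly (map_poly of_int P) w"

lemma ipoly_altdef: "ipoly P w = (\<Sum>l\<le>degree P. of_int (poly.coeff P l) * w ^ l)"
  by (simp add: poly_altdef coeff_map_poly degree_map_poly)

text \<open>An eigenvalue of an integer matrix is a root of the characteristic polynomial, which is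
  monic with integer coefficients.\<close>

lemma algebraic_int_ipoly_root_of_unity:
  assumes "N > 0" "w ^ N = 1"
  shows "algebraic_int (ipoly P w)"
proof -
  define d where "d = degree P"
  define c where "c = poly.coeff P"
  define M :: "int mat" where
    "M = mat N N (\<lambda>(i, j). \<Sum>l | l \<in> {..d} \<and> (i + l) mod N = j. c l)"
  define M' :: "complex mat" where "M' = map_mat of_int M"
  define v where "v = vec N (\<lambda>j. w ^ j)"
  have M: "M \<in> carrier_mat N N" by (simp add: M_def)
  have M': "M' \<in> carrier_mat N N" by (simp add: M'_def M_def)
  note wmod = power_mod_root_of_unity[OF assms(2)]
  have "eigenvector M' v (ipoly P w)"
    \<comment> \<open>\<open>M\<close> is the matrix of multiplication by P(w) on the generators 1, w, ..., w^(N-1).\<close>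
    unfolding eigenvector_def
  proof (intro conjI)
    show "v \<in> carrier_vec (dim_row M')" using M' by (simp add: v_def)
    have "v $ 0 \<noteq> 0\<^sub>v (dim_row M') $ 0" using M' assms(1) by (simp add: v_def)
    then show "v \<noteq> 0\<^sub>v (dim_row M')" by auto
    show "M' *\<^sub>v v = ipoly P w \<cdot>\<^sub>v v"
    proof (rule eq_vecI)
      fix i assume "i < dim_vec (ipoly P w \<cdot>\<^sub>v v)"
      then have i: "i < N" by (simp add: v_def)
      have "(M' *\<^sub>v v) $ i = (\<Sum>j<N. of_int (M $$ (i, j)) * w ^ j)"
        using i M by (simp add: M'_def v_def scalar_prod_def lessThan_atLeast0)
      also have "\<dots> = (\<Sum>j<N. \<Sum>l | l \<in> {..d} \<and> (i + l) mod N = j. of_int (c l) * w ^ ((i + l) mod N))"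
        using i by (intro sum.cong refl) (simp add: M_def sum_distrib_right)
      also have "\<dots> = (\<Sum>l\<le>d. of_int (c l) * w ^ ((i + l) mod N))"
        using assms(1) by (intro sum.group) auto
      also have "\<dots> = ipoly P w * w ^ i"
        by (simp add: wmod ipoly_altdef sum_distrib_right sum_distrib_left power_add c_def d_def mult_ac)
      finally show "(M' *\<^sub>v v) $ i = (ipoly P w \<cdot>\<^sub>v v) $ i"
        using i by (simp add: v_def)
    qed (use M' in \<open>simp add: v_def\<close>)
  qed
  then have "poly (char_poly M') (ipoly P w) = 0"
    using eigenvalue_root_char_poly[OF M'] by (auto simp: eigenvalue_def)
  moreover have "char_poly M' = map_poly of_int (char_poly M)"
    unfolding M'_def by (rule of_int_hom.char_poly_hom[OF M])
  moreover have "lead_coeff (char_poly M) = 1"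
    using degree_monic_char_poly[OF M] by simp
  ultimately show ?thesis
    unfolding algebraic_int_altdef_ipoly by auto
qed

text \<open>Removing factors \<open>X\<close> from an integer polynomial that vanishes at
  \<open>z\<close> makes its constant term nonzero; up to sign, that term is then a multiple of
  \<open>z\<close>.\<close>

lemma algebraic_dvd_nonzero_int:
  fixes z :: complex
  assumes "algebraic z" "z \<noteq> 0"
  obtains D :: int and Q :: "int poly" where "D \<noteq> 0" "of_int D = z * ipoly Q z"
proof -
  have "\<exists>D Q. D \<noteq> 0 \<and> of_int D = z * ipoly Q z" if "f \<noteq> 0" "ipoly f z = 0" for f
    using that
  proof (induction f rule: pCons_induct)
    case 0
    then show ?case by simp
  next
    case (pCons a f)
    from pCons.prems have eq: "of_int a + z * ipoly f z = 0"
      by (simp add: map_poly_pCons)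
    show ?case
    proof (cases "a = 0")
      case True
      with eq assms(2) pCons show ?thesis by auto
    next
      case False
      then show ?thesis
        using eq by (intro exI[of _ "-a"] exI[of _ f]) (auto simp: add_eq_0_iff)
    qed
  qed
  moreover obtain f where "f \<noteq> 0" "ipoly f z = 0"
  proof -
    obtain p where p: "\<And>i. poly.coeff p i \<in> \<int>" "p \<noteq> 0" "poly p z = 0"
      using assms(1) unfolding algebraic_def by blast
    obtain f where "p = map_poly of_int f" using intpolyE[OF p(1)] by blast
    with p that[of f] show thesis by auto
  qed
  ultimately show thesis using that by blast
qed

section \<open>Congruences modulo a prime and the Frobenius map\<close>

lemma prime_dvd_power_sum:
  fixes u v :: "'a :: comm_ring_1"
  assumes "prime p"
  shows "of_nat p dvd (u + v) ^ p - (u ^ p + v ^ p)"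
proof -
  have p: "p > 0" using assms prime_gt_0_nat by blast
  have "(u + v) ^ p = (\<Sum>k\<le>p. of_nat (p choose k) * u ^ k * v ^ (p - k))"
    by (rule binomial_ring)
  also have "{..p} = insert 0 (insert p {0<..<p})" using p by auto
  also have "(\<Sum>k\<in>insert 0 (insert p {0<..<p}). of_nat (p choose k) * u ^ k * v ^ (p - k)) =
      v ^ p + (u ^ p + (\<Sum>k\<in>{0<..<p}. of_nat (p choose k) * u ^ k * v ^ (p - k)))"
    using p by simp
  finally have "(u + v) ^ p - (u ^ p + v ^ p) =
      (\<Sum>k\<in>{0<..<p}. of_nat (p choose k) * u ^ k * v ^ (p - k))"
    by simp
  moreover have "of_nat p dvd (of_nat (p choose k) * u ^ k * v ^ (p - k))" if "k \<in> {0<..<p}" for k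
  proof -
    have "p dvd p choose k"
      using that assms by (intro dvd_choose_prime) auto
    then show ?thesis by (auto elim!: dvdE simp: mult_ac)
  qed
  ultimately show ?thesis by (auto intro!: dvd_sum)
qed

lemma fermat_int:
  fixes a :: int
  assumes "prime p"
  shows "int p dvd a ^ p - a"
proof (induction a rule: int_induct[where k = 0])
  case base
  then show ?case using assms prime_gt_0_nat by (simp add: power_0_left)
next
  case (step1 a)
  have "(a + 1) ^ p - (a + 1) = ((a + 1) ^ p - (a ^ p + 1 ^ p)) + (a ^ p - a)" by simp
  then show ?case
    using step1.IH prime_dvd_power_sum[OF assms, of a 1] by (metis dvd_add)
next
  case (step2 a)
  have "(a - 1) ^ p - (a - 1) = (a ^ p - a) - ((a - 1 + 1) ^ p - ((a - 1) ^ p + 1 ^ p))" by simp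
  then show ?case
    using step2.IH prime_dvd_power_sum[OF assms, of "a - 1" 1] by (metis dvd_diff)
qed

text \<open>Modulo \<open>p\<close>, the power of \<open>[:a:] + X * P\<close> splits into the
  powers of the two summands, and Fermat's little theorem replaces \<open>[:a:] ^ p\<close> by
  \<open>[:a:]\<close>.\<close>

lemma frobenius_int_poly:
  fixes P :: "int poly"
  assumes "prime p"
  shows "of_nat p dvd P \<circ>\<^sub>p Polynomial.monom 1 p - P ^ p"
proof (induction P)
  case 0
  then show ?case using assms prime_gt_0_nat by (simp add: power_0_left)
next
  case (pCons a P)
  have eq: "pCons a P = [:a:] + Polynomial.monom 1 1 * P" by (simp add: monom_Suc)
  have "pCons a P \<circ>\<^sub>p Polynomial.monom 1 p - pCons a P ^ p =
      - (([:a:] + Polynomial.monom 1 1 * P) ^ p - ([:a:] ^ p + (Polynomial.monom 1 1 * P) ^ p)) - ([:a:] ^ p - [:a:])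
      + Polynomial.monom 1 p * (P \<circ>\<^sub>p Polynomial.monom 1 p - P ^ p)"
    unfolding eq[symmetric] by (simp add: pcompose_pCons power_mult_distrib monom_power algebra_simps)
  moreover have "of_nat p dvd [:a:] ^ p - [:a:]"
  proof -
    obtain c where "a ^ p - a = int p * c" using fermat_int[OF assms] by blast
    then have "[:a:] ^ p - [:a:] = of_nat p * [:c:]"
      by (simp add: poly_const_pow of_nat_poly)
    then show ?thesis by (rule dvdI)
  qed
  ultimately show ?case
    using pCons.IH prime_dvd_power_sum[OF assms, of "[:a:]" "Polynomial.monom 1 1 * P"]
    by (metis dvd_add dvd_diff dvd_minus_iff dvd_mult)
qed

text \<open>
  If P(w) = 0, then P(w^p) is divisible by p in the ring of all Q(w). A nonzero element of this
  ring divides a nonzero integer, hence is divisible by only finitely many primes.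
\<close>
lemma ipoly_zero_prime_power:
  assumes "N > 0"
  obtains M :: nat where
    "\<And>p w. prime p \<Longrightarrow> p > M \<Longrightarrow> w ^ N = 1 \<Longrightarrow> ipoly P w = 0 \<Longrightarrow> ipoly P (w ^ p) = 0"
proof -
  define U where "U = {u :: complex. u ^ N = 1 \<and> ipoly P u \<noteq> 0}"
  have "finite U"
    using finite_roots_unity[of N, where 'a = complex] assms
    by (auto simp: U_def elim: finite_subset[rotated])
  have "\<exists>D Q. D \<noteq> 0 \<and> of_int D = ipoly P u * ipoly Q (ipoly P u)" if "u \<in> U" for u
    using algebraic_dvd_nonzero_int[of "ipoly P u"] algebraic_int_ipoly_root_of_unity[OF assms, of u P] that
    unfolding U_def by (metis (mono_tags, lifting) algebraic_int_imp_algebraic mem_Collect_eq)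
  then obtain D Q where DQ: "\<And>u. u \<in> U \<Longrightarrow> D u \<noteq> 0"
    "\<And>u. u \<in> U \<Longrightarrow> of_int (D u) = ipoly P u * ipoly (Q u) (ipoly P u)"
    by metis
  \<comment> \<open>\<open>M\<close> bounds all \<open>D u\<close> in absolute value, so no larger
    prime divides one of them. The inserted 0 keeps \<open>Max\<close> meaningful when
    \<open>U\<close> is empty.\<close>
  define M where "M = Max (insert 0 ((\<lambda>u. nat \<bar>D u\<bar>) ` U))"
  have M: "nat \<bar>D u\<bar> \<le> M" if "u \<in> U" for u
    unfolding M_def using \<open>finite U\<close> that by (intro Max_ge) auto
  have "ipoly P (w ^ p) = 0" if p: "prime p" "p > M" and w: "w ^ N = 1" "ipoly P w = 0" for p w
  proof (rule ccontr)
    assume "ipoly P (w ^ p) \<noteq> 0"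
    moreover have "(w ^ p) ^ N = 1"
      using w(1) by (metis power_commutes power_mult power_one mult.commute)
    ultimately have U: "w ^ p \<in> U" by (simp add: U_def)
    obtain h where h: "P \<circ>\<^sub>p Polynomial.monom 1 p - P ^ p = of_nat p * h"
      using frobenius_int_poly[OF p(1)] by blast
    have p0: "p > 0" using p(1) prime_gt_0_nat by blast
    have "P \<circ>\<^sub>p Polynomial.monom 1 p = P ^ p + of_nat p * h" using h by (simp add: algebra_simps)
    then have "ipoly (P \<circ>\<^sub>p Polynomial.monom 1 p) w = ipoly (P ^ p + of_nat p * h) w" by simp
    then have eq: "ipoly P (w ^ p) = of_nat p * ipoly h w"
      using w(2) p0
      by (simp add: of_nat_poly of_int_hom.map_poly_pCons_hom of_int_hom.map_poly_hom_smult zero_power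
          of_int_hom.map_poly_pcompose poly_pcompose poly_monom of_int_poly_hom.hom_add
          of_int_poly_hom.hom_mult of_int_poly_hom.hom_power)
    define R where "R = h * (Q (w ^ p) \<circ>\<^sub>p (P \<circ>\<^sub>p Polynomial.monom 1 p))"
    have R: "of_int (D (w ^ p)) = of_nat p * ipoly R w"
      using DQ(2)[OF U] eq
      by (simp add: R_def of_int_hom.map_poly_pcompose poly_pcompose poly_monom of_int_poly_hom.hom_mult)
    \<comment> \<open>The quotient is rational and an algebraic integer, hence an integer; this
      brings divisibility by \<open>p\<close> down to the integers.\<close>
    have "ipoly R w = of_int (D (w ^ p)) / of_nat p"
      using R p0 by simp
    then have "ipoly R w \<in> \<rat>" by simp
    then have "ipoly R w \<in> \<int>"
      using algebraic_int_ipoly_root_of_unity[OF assms w(1)] rational_algebraic_int_is_int by blast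
    then obtain n where "ipoly R w = of_int n" by (elim Ints_cases)
    with R have "of_int (D (w ^ p)) = (of_int (int p * n) :: complex)" by simp
    then have "D (w ^ p) = int p * n" by (simp only: of_int_eq_iff)
    then have "int p dvd D (w ^ p)" by simp
    then have "int p \<le> \<bar>D (w ^ p)\<bar>"
      using DQ(1)[OF U] by (simp add: zdvd_imp_le)
    then show False using M[OF U] p(2) by linarith
  qed
  then show thesis using that by blast
qed

text \<open>For \<open>N\<close>-th roots of unity only the residue of an exponent modulo
  \<open>N\<close> matters. Hence \<open>b\<close> may be traded for \<open>c\<close>, to which a
  result about large primes applies factor by factor.\<close>

lemma exists_cong_all_prime_divisors_gt:
  fixes b N M :: nat
  assumes "coprime b N" "N > 0"
  obtains c where "c > 0" "[c = b] (mod N)" "\<And>p. prime p \<Longrightarrow> p dvd c \<Longrightarrow> p > M"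
proof -
  \<comment> \<open>A prime up to M divides exactly one of the two summands of \<open>c\<close> below.\<close>
  define T where "T = {p. prime p \<and> p \<le> M \<and> \<not> p dvd b}"
  have fin: "finite T" by (rule finite_subset[of _ "{..M}"]) (auto simp: T_def)
  define c where "c = b + N * \<Prod>T"
  have dvdT: "p dvd \<Prod>T \<longleftrightarrow> p \<in> T" if p: "prime p" "p \<le> M" for p
  proof
    assume "p dvd \<Prod>T"
    then obtain p' where "p' \<in> T" "p dvd p'"
      using p(1) fin prime_dvd_prod_iff[of T p "\<lambda>x. x"] by auto
    then show "p \<in> T" using p(1) primes_dvd_imp_eq unfolding T_def by blast
  qed (use fin in \<open>auto intro: dvd_prodI\<close>)
  show thesis
  proof
    have "\<Prod>T > 0" by (intro prod_pos) (auto simp: T_def prime_gt_0_nat)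
    then show "c > 0" using assms(2) by (simp add: c_def)
    show "[c = b] (mod N)" by (simp add: c_def cong_def)
    show "p > M" if p: "prime p" "p dvd c" for p
    proof (rule ccontr)
      assume "\<not> p > M"
      then have le: "p \<le> M" by simp
      show False
      proof (cases "p dvd b")
        case True
        then have "p dvd N * \<Prod>T" using p(2) by (simp add: c_def dvd_add_right_iff)
        moreover have "\<not> p dvd N"
          using True assms(1) p(1) by (metis coprime_common_divisor not_prime_unit)
        ultimately have "p \<in> T" using dvdT le p(1) by (simp add: prime_dvd_mult_iff)
        then show False using True by (simp add: T_def)
      next
        case False
        then have "p \<in> T" using p(1) le by (simp add: T_def)
        then have "p dvd N * \<Prod>T" using dvdT le p(1) by simp
        then show False using p(2) False by (simp add: c_def dvd_add_left_iff)
      qed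
    qed
  qed
qed

text \<open>The threshold \<open>M\<close> is the same for all \<open>N\<close>-th roots of unity,
  so the prime factors of \<open>c\<close> can be peeled off one by one while \<open>w\<close> is
  replaced by \<open>w ^ p\<close>.\<close>

lemma ipoly_zero_power_coprime:
  assumes "w ^ N = 1" "N > 0" "coprime b N" "ipoly P w = 0"
  shows "ipoly P (w ^ b) = 0"
proof -
  obtain M where M: "\<And>p w. prime p \<Longrightarrow> p > M \<Longrightarrow> w ^ N = 1 \<Longrightarrow> ipoly P w = 0 \<Longrightarrow> ipoly P (w ^ p) = 0"
    using ipoly_zero_prime_power[OF assms(2)] by blast
  obtain c where c: "c > 0" "[c = b] (mod N)" "\<And>p. prime p \<Longrightarrow> p dvd c \<Longrightarrow> p > M"
    using exists_cong_all_prime_divisors_gt[OF assms(3,2)] by blast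
  have "ipoly P (w ^ c) = 0"
    using c(1,3) assms(1,4)
  proof (induction c arbitrary: w rule: less_induct)
    case (less c)
    show ?case
    proof (cases "c = 1")
      case False
      then obtain p where p: "prime p" "p dvd c" using prime_factor_nat by blast
      then obtain d where d: "c = p * d" by blast
      have "d < c" "d > 0" using d p(1) less.prems(1) prime_gt_1_nat by auto
      moreover have "(w ^ p) ^ N = 1" 
        using less.prems(3) by (metis power_commutes power_mult power_one mult.commute)
      moreover have "ipoly P (w ^ p) = 0"
        using M p less.prems by blast
      ultimately have "ipoly P ((w ^ p) ^ d) = 0"
        using less.prems(2) d by (intro less.IH[of d "w ^ p"]) auto
      then show ?thesis by (simp add: d power_mult)
    qed (use less.prems in simp)
  qed
  moreover have "w ^ c = w ^ b"
    using assms(1) c(2) by (rule power_cong_root_of_unity)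
  ultimately show ?thesis by simp
qed

text \<open>A predicate on complex polynomials, so that they can be evaluated at roots of unity
  without mapping coefficients.\<close>

definition rat_coeffs :: "complex poly \<Rightarrow> bool" where
  "rat_coeffs P \<longleftrightarrow> (\<forall>i. poly.coeff P i \<in> \<rat>)"

lemma rat_coeffs_simps [simp]: "rat_coeffs 0" "rat_coeffs (pCons a P) \<longleftrightarrow> a \<in> \<rat> \<and> rat_coeffs P"
  by (auto simp: rat_coeffs_def coeff_pCons split: nat.splits)

lemma rat_coeffs_clear_denominators:
  assumes "rat_coeffs P"
  obtains D :: int and Q where "D \<noteq> 0" "Polynomial.smult (of_int D) P = map_poly of_int Q"
proof -
  have "\<exists>D Q. D \<noteq> 0 \<and> Polynomial.smult (of_int D) P = map_poly of_int Q"
    using assms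
  proof (induction P rule: pCons_induct)
    case 0
    show ?case by (intro exI[of _ 1] exI[of _ 0]) simp
  next
    case (pCons a P)
    then obtain D Q where DQ: "D \<noteq> 0" "Polynomial.smult (of_int D) P = map_poly of_int Q" by auto
    from pCons.prems have "a \<in> \<rat>" by simp
    then obtain m n where mn: "n > 0" "a = of_int m / of_int n" by (elim Rats_cases')
    have "Polynomial.smult (of_int n) (Polynomial.smult (of_int D) P) = map_poly of_int (Polynomial.smult n Q)"
      unfolding DQ(2) by (simp add: of_int_hom.map_poly_hom_smult)
    then have "Polynomial.smult (of_int (D * n)) (pCons a P) = map_poly of_int (pCons (D * m) (Polynomial.smult n Q))"
      using mn by (simp add: of_int_hom.map_poly_pCons_hom mult_ac)
    with DQ mn show ?case by (intro exI[of _ "D * n"]) auto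
  qed
  then show thesis using that by blast
qed

text \<open>Plays the part of the automorphism of the cyclotomic field that sends \<open>w\<close>
  to \<open>w ^ b\<close>: rational relations between powers of \<open>w\<close> survive it.\<close>

lemma rat_poly_zero_power_coprime:
  assumes "rat_coeffs P" "w ^ N = 1" "N > 0" "coprime b N" "poly P w = 0"
  shows "poly P (w ^ b) = 0"
proof -
  obtain D Q where DQ: "D \<noteq> 0" "Polynomial.smult (of_int D) P = map_poly of_int Q"
    using rat_coeffs_clear_denominators[OF assms(1)] .
  have eq: "ipoly Q u = of_int D * poly P u" for u
    unfolding DQ(2)[symmetric] by simp
  have "ipoly Q (w ^ b) = 0"
    using ipoly_zero_power_coprime[OF assms(2-4), of Q] assms(5) eq by simp
  with eq DQ(1) show ?thesis by simp
qed

lemma rat_coeffs_add: "rat_coeffs P \<Longrightarrow> rat_coeffs Q \<Longrightarrow> rat_coeffs (P + Q)"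
  by (simp add: rat_coeffs_def)

lemma rat_coeffs_diff: "rat_coeffs P \<Longrightarrow> rat_coeffs Q \<Longrightarrow> rat_coeffs (P - Q)"
  by (simp add: rat_coeffs_def)

lemma rat_coeffs_mult: "rat_coeffs P \<Longrightarrow> rat_coeffs Q \<Longrightarrow> rat_coeffs (P * Q)"
  by (auto simp: rat_coeffs_def coeff_mult intro!: Rats_sum Rats_mult)

lemma rat_coeffs_smult: "c \<in> \<rat> \<Longrightarrow> rat_coeffs P \<Longrightarrow> rat_coeffs (Polynomial.smult c P)"
  by (simp add: rat_coeffs_def)

lemma rat_coeffs_sum: "(\<And>i. i \<in> A \<Longrightarrow> rat_coeffs (f i)) \<Longrightarrow> rat_coeffs (\<Sum>i\<in>A. f i)"
  by (auto simp: rat_coeffs_def coeff_sum intro!: Rats_sum)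

lemma rat_coeffs_monom: "c \<in> \<rat> \<Longrightarrow> rat_coeffs (Polynomial.monom c n)"
  by (simp add: rat_coeffs_def)

lemma rat_coeffs_pderiv: "rat_coeffs P \<Longrightarrow> rat_coeffs (pderiv P)"
  by (auto simp: rat_coeffs_def coeff_pderiv intro!: Rats_mult)

lemma rat_coeffs_pcompose: "rat_coeffs P \<Longrightarrow> rat_coeffs Q \<Longrightarrow> rat_coeffs (P \<circ>\<^sub>p Q)"
  by (induction P) (auto simp: pcompose_pCons intro!: rat_coeffs_add rat_coeffs_mult)

section \<open>Reflection of the Hurwitz zeta function\<close>

abbreviation hz :: "nat \<Rightarrow> real \<Rightarrow> real" where
  "hz k x \<equiv> Re (hurwitz_zeta (of_nat k) x)"

lemma hz_sums:
  assumes "k > 1" "x > 0"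
  shows "(\<lambda>n. 1 / (real n + x) ^ k) sums hz k x"
  using hurwitz_zeta_of_nat[OF assms] by (simp add: sums_iff)

section \<open>Reflection formulas for the polygamma functions\<close>

lemma sin_pi_mult_nonzero:
  fixes z :: complex
  assumes "z \<notin> \<int>"
  shows "sin (of_real pi * z) \<noteq> 0"
proof
  assume "sin (of_real pi * z) = 0"
  then obtain n :: int where "of_real pi * z = of_int n * of_real pi"
    by (auto simp: sin_eq_0)
  then have "z = of_int n" by (simp add: mult.commute)
  with assms show False by simp
qed

text \<open>Logarithmic derivative of the reflection formula for \<open>rGamma\<close>, whose right
  side is \<open>sin (pi * z) / pi\<close>.\<close>

lemma Digamma_reflection:
  fixes z :: complex
  assumes "z \<notin> \<int>"
  shows "Digamma (1 - z) - Digamma z = of_real pi * cot (of_real pi * z)"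
proof -
  have z: "z \<notin> \<int>\<^sub>\<le>\<^sub>0" "1 - z \<notin> \<int>\<^sub>\<le>\<^sub>0"
    using assms Ints_diff[OF Ints_1, of "1 - z"] by (auto dest: nonpos_Ints_Int)
  note nz = sin_pi_mult_nonzero[OF assms]
  have "((\<lambda>z. rGamma z * rGamma (1 - z)) has_field_derivative
      rGamma z * rGamma (1 - z) * (Digamma (1 - z) - Digamma z)) (at z)"
    using z by (auto intro!: derivative_eq_intros DERIV_chain2[where g = "\<lambda>z. 1 - z"] simp: algebra_simps)
  moreover have "((\<lambda>z. rGamma z * rGamma (1 - z)) has_field_derivative cos (of_real pi * z)) (at z)"
    unfolding rGamma_reflection_complex by (auto intro!: derivative_eq_intros)
  ultimately have "rGamma z * rGamma (1 - z) * (Digamma (1 - z) - Digamma z) = cos (of_real pi * z)"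
    by (rule DERIV_unique)
  then show ?thesis
    using nz by (simp add: rGamma_reflection_complex cot_def field_simps)
qed

text \<open>With y(z) = -i cot(pi z) one has y' = pi i (1 - y^2), which gives the recursion.\<close>
primrec reflection_poly :: "nat \<Rightarrow> complex poly" where
  "reflection_poly 0 = [:0, 1:]"
| "reflection_poly (Suc m) = [:1, 0, -1:] * pderiv (reflection_poly m)"

text \<open>The digamma case differentiated \<open>m\<close> times; the sign comes from the inner
  derivative of \<open>1 - z\<close>.\<close>

lemma Polygamma_reflection:
  fixes z :: complex
  assumes "z \<notin> \<int>"
  shows "(-1) ^ m * Polygamma m (1 - z) - Polygamma m z =
    (of_real pi * \<i>) ^ Suc m * poly (reflection_poly m) (- \<i> * cot (of_real pi * z))"
  using assms
proof (induction m arbitrary: z)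
  case 0
  then show ?case using Digamma_reflection[of z] by (simp add: mult.assoc)
next
  case (Suc m)
  have z: "z \<notin> \<int>\<^sub>\<le>\<^sub>0" "1 - z \<notin> \<int>\<^sub>\<le>\<^sub>0"
    using Suc.prems Ints_diff[OF Ints_1, of "1 - z"] by (auto dest: nonpos_Ints_Int)
  note nz = sin_pi_mult_nonzero[OF Suc.prems]
  let ?f = "\<lambda>z. (-1) ^ m * Polygamma m (1 - z) - Polygamma m z :: complex"
  let ?y = "\<lambda>z. - \<i> * cot (of_real pi * z)"
  let ?g = "\<lambda>z. (of_real pi * \<i>) ^ Suc m * poly (reflection_poly m) (?y z)"
  have "(?f has_field_derivative
      (-1) ^ Suc m * Polygamma (Suc m) (1 - z) - Polygamma (Suc m) z) (at z)"
    using z by (auto intro!: derivative_eq_intros DERIV_chain2[where g = "\<lambda>z. 1 - z"])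
  moreover have "(?f has_field_derivative
      (of_real pi * \<i>) ^ Suc (Suc m) * poly (reflection_poly (Suc m)) (?y z)) (at z)"
  \<comment> \<open>The induction hypothesis identifies the two functions only off the integers,
    which is an open set around \<open>z\<close>.\<close>
  proof (rule has_field_derivative_transform_within_open[where S = "- \<int>"])
    have "inverse ((sin (of_real pi * z))\<^sup>2) = 1 + (cot (of_real pi * z))\<^sup>2"
      using nz sin_cos_squared_add[of "of_real pi * z"]
      by (simp add: cot_def divide_simps power_divide)
    moreover have "(?y has_field_derivative
        - \<i> * (- inverse ((sin (of_real pi * z))\<^sup>2) * of_real pi)) (at z)"
      using nz by (auto intro!: derivative_eq_intros DERIV_chain2[OF DERIV_cot])
    ultimately have "(?y has_field_derivative of_real pi * \<i> * (1 - ?y z * ?y z)) (at z)"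
      by (simp add: power2_eq_square algebra_simps)
    then have "(?g has_field_derivative (of_real pi * \<i>) ^ Suc m *
        (poly (pderiv (reflection_poly m)) (?y z) * (of_real pi * \<i> * (1 - ?y z * ?y z)))) (at z)"
      by (intro DERIV_cmult DERIV_chain2[OF poly_DERIV])
    then show "(?g has_field_derivative
        (of_real pi * \<i>) ^ Suc (Suc m) * poly (reflection_poly (Suc m)) (?y z)) (at z)"
      by (rule DERIV_cong) (simp add: algebra_simps)
  qed (use Suc in \<open>auto simp: closed_Ints open_Compl\<close>)
  ultimately show ?case by (rule DERIV_unique)
qed

text \<open>On positive reals the polygamma function of order \<open>k - 1\<close> is
  \<open>- fact (k - 1)\<close> times \<open>hz k\<close>. Since \<open>k - 1\<close> is even,
  reflection gives a difference and not a sum.\<close>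

lemma hz_reflection:
  assumes "k > 1" "odd k" "0 < x" "x < 1"
  shows "complex_of_real (hz k x - hz k (1 - x)) =
    (of_real pi * \<i>) ^ k * (poly (reflection_poly (k - 1)) (- \<i> * cot (of_real (pi * x))) / fact (k - 1))"
proof -
  define m where "m = k - 1"
  have m: "k = Suc m" "even m" "m > 0" using assms by (auto simp: m_def)
  have P: "Polygamma m (complex_of_real t) = - fact m * of_real (hz k t)" if "t > 0" for t
  proof -
    have "Polygamma m t = - fact m * (\<Sum>n. inverse ((t + real n) ^ Suc m))"
      using m by (simp add: Polygamma_def)
    also have "(\<Sum>n. inverse ((t + real n) ^ Suc m)) = hz k t"
      using sums_unique[OF hz_sums[OF assms(1) that]] m by (simp add: add.commute divide_inverse)
    finally show ?thesis using that
      by (simp add: Polygamma_of_real)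
  qed
  have "complex_of_real x \<notin> \<int>"
  proof
    assume "complex_of_real x \<in> \<int>"
    then have "x \<in> \<int>" by simp
    then obtain n :: int where "x = of_int n" by (elim Ints_cases)
    with assms show False by auto
  qed
  from Polygamma_reflection[OF this, of m] 
  have "fact m * complex_of_real (hz k x - hz k (1 - x)) = 
    (of_real pi * \<i>) ^ k * poly (reflection_poly m) (- \<i> * cot (of_real pi * of_real x))"
    using P[of x] P[of "1 - x"] assms m by (simp add: algebra_simps)
  then show ?thesis by (simp add: m_def field_simps)
qed

section \<open>Cotangent values in terms of roots of unity\<close>

lemma cot_conv_cis:
  assumes "sin t \<noteq> 0"
  shows "- \<i> * cot (complex_of_real t) = (cis (2 * t) + 1) / (cis (2 * t) - 1)"
proof -
  have eq: "cis (2 * t) = cis t * cis t" "1 = cis t * cis (-t)"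
    by (simp_all add: cis_mult)
  have "cis (2 * t) + 1 = cis t * (cis t + cis (-t))" "cis (2 * t) - 1 = cis t * (cis t - cis (-t))"
    unfolding distrib_left right_diff_distrib by (simp_all only: eq[symmetric])
  moreover have "cis t + cis (-t) = 2 * of_real (cos t)" "cis t - cis (-t) = 2 * (\<i> * of_real (sin t))"
    by (simp_all add: complex_eq_iff)
  ultimately have "(cis (2 * t) + 1) / (cis (2 * t) - 1) =
      (cis t * (2 * of_real (cos t))) / (cis t * (2 * (\<i> * of_real (sin t))))"
    by (simp only:)
  also have "\<dots> = of_real (cos t) / (\<i> * of_real (sin t))" by simp
  also have "\<dots> = - \<i> * cot (complex_of_real t)"
    by (simp add: cot_def sin_of_real[symmetric] cos_of_real[symmetric] divide_simps)
  finally show ?thesis ..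
qed

text \<open>Turns \<open>1 / (w - 1)\<close> into a polynomial in \<open>w\<close> with rational
  coefficients, so that division disappears from the cotangent values.\<close>

lemma inverse_root_of_unity_minus_one:
  fixes w :: complex
  assumes "w ^ q = 1" "w \<noteq> 1" "q > 0"
  shows "(\<Sum>j<q. of_nat j * w ^ j) = of_nat q / (w - 1)"
proof -
  have "(w - 1) * (\<Sum>j<n. of_nat j * w ^ j) = of_nat n * w ^ n - (\<Sum>j<n. w ^ Suc j)" for n
    by (induction n) (simp_all add: algebra_simps)
  from this[of q] have "(w - 1) * (\<Sum>j<q. of_nat j * w ^ j) = of_nat q - w * (\<Sum>j<q. w ^ j)"
    using assms by (simp add: sum_distrib_left)
  also have "(\<Sum>j<q. w ^ j) = 0"
    using assms by (simp add: geometric_sum)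
  finally show ?thesis using assms by (simp add: field_simps)
qed

section \<open>Residue classes and the Riemann zeta value\<close>

text \<open>The Riemann zeta value at \<open>k\<close>; for \<open>k > 0\<close> the term at
  \<open>n = 0\<close> is \<open>inverse 0 = 0\<close>.\<close>

abbreviation zt :: "nat \<Rightarrow> real" where
  "zt k \<equiv> (\<Sum>n. inverse (real n ^ k))"

lemma zt_sums: "k > 1 \<Longrightarrow> (\<lambda>n. inverse (real n ^ k)) sums zt k"
  by (intro summable_sums inverse_power_summable) auto

text \<open>With \<open>n = m * q + a\<close>, the terms in the residue class of \<open>a\<close>
  add up to \<open>hz k (a / q) / q ^ k\<close>.\<close>

lemma hz_sum_residues:
  assumes "k > 1" "q > 0" "A \<subseteq> {1..<q}"
  shows "(\<lambda>n. if n mod q \<in> A then inverse (real n ^ k) else 0) sums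
    ((\<Sum>a\<in>A. hz k (real a / real q)) / real q ^ k)"
proof -
  let ?f = "\<lambda>n. if n mod q \<in> A then inverse (real n ^ k) else 0"
  have fin: "finite A" using assms(3) finite_subset by blast
  have "summable ?f"
    by (rule summable_comparison_test'[OF sums_summable[OF zt_sums[OF assms(1)]], of 0]) auto
  then have f: "?f sums suminf ?f" by (rule summable_sums)
  have "(\<lambda>n. inverse (real (n * q + a) ^ k)) sums (hz k (real a / real q) / real q ^ k)" if "a \<in> A" for a
  proof -
    have "(\<lambda>n. 1 / (real n + real a / real q) ^ k / real q ^ k) sums (hz k (real a / real q) / real q ^ k)"
      using that assms by (intro sums_divide hz_sums) auto
    moreover have "1 / (real n + real a / real q) ^ k / real q ^ k = inverse (real (n * q + a) ^ k)" for n
    proof -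
      have "real (n * q + a) = (real n + real a / real q) * real q"
        using assms(2) by (simp add: field_simps)
      then show ?thesis by (simp only: power_mult_distrib) (simp add: divide_inverse)
    qed
    ultimately show ?thesis by simp
  qed
  then have "(\<lambda>n. \<Sum>a\<in>A. inverse (real (n * q + a) ^ k)) sums (\<Sum>a\<in>A. hz k (real a / real q) / real q ^ k)"
    by (rule sums_sum)
  \<comment> \<open>The \<open>n\<close>-th terms of these series form one block of \<open>q\<close>
    consecutive integers, so the sum agrees with the grouped series.\<close>
  moreover have "(\<Sum>a\<in>A. inverse (real (n * q + a) ^ k)) = sum ?f {n * q..<n * q + q}" for n
  proof -
    have "sum ?f {n * q..<n * q + q} = sum (\<lambda>a. ?f (a + n * q)) {0..<q}"
      using sum.shift_bounds_nat_ivl[of ?f 0 "n * q" q] by (simp add: add.commute)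
    also have "\<dots> = (\<Sum>a\<in>{0..<q}. if a \<in> A then inverse (real (n * q + a) ^ k) else 0)"
      by (intro sum.cong) (auto simp: add.commute)
    also have "\<dots> = (\<Sum>a\<in>A. inverse (real (n * q + a) ^ k))"
      using assms(3) by (subst sum.inter_restrict[symmetric]) (auto intro!: sum.cong)
    finally show ?thesis ..
  qed
  ultimately have "(\<lambda>n. sum ?f {n * q..<n * q + q}) sums ((\<Sum>a\<in>A. hz k (real a / real q)) / real q ^ k)"
    by (simp add: sum_divide_distrib)
  with sums_group[OF f assms(2)] have "suminf ?f = (\<Sum>a\<in>A. hz k (real a / real q)) / real q ^ k"
    by (rule sums_unique2)
  with f show ?thesis by simp
qed

text \<open>For \<open>n \<ge> 2\<close> each term is at most half of \<open>1 / n ^ 2\<close>. This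
  gives the bound \<open>pi ^ 2 / 12 + 1 / 2\<close>, which is below 2 because
  \<open>pi < 4\<close>.\<close>

lemma zt_less_2:
  assumes "k \<ge> 3"
  shows "zt k < 2"
proof -
  have "(\<lambda>n. inverse (real n ^ 2)) sums (pi\<^sup>2 / 6)"
  proof -
    have "(\<lambda>n. 1 / real ((n + 1)\<^sup>2)) = (\<lambda>n. inverse (real (Suc n) ^ 2))"
      by (simp only: of_nat_power inverse_eq_divide Suc_eq_plus1)
    with inverse_squares_sums have "(\<lambda>n. inverse (real (Suc n) ^ 2)) sums (pi\<^sup>2 / 6)" by simp
    from sums_Suc[OF this] show ?thesis by simp
  qed
  then have bound: "(\<lambda>n. inverse (real n ^ 2) / 2 + (if n = 1 then 1 / 2 else 0)) sums (pi\<^sup>2 / 6 / 2 + 1 / 2)"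
    by (intro sums_add sums_divide sums_single[of 1 "\<lambda>_. 1 / 2"])
  have le: "inverse (real n ^ k) \<le> inverse (real n ^ 2) / 2 + (if n = 1 then 1 / 2 else 0)" for n
  proof (cases "n \<ge> 2")
    case True
    have "2 * real n ^ 2 \<le> real n * real n ^ 2" using True by (intro mult_right_mono) auto
    also have "\<dots> = real n ^ 3" by (simp add: power_numeral_reduce)
    also have "\<dots> \<le> real n ^ k" using True assms by (intro power_increasing) auto
    finally have "inverse (real n ^ k) \<le> inverse (2 * real n ^ 2)"
      using True by (intro le_imp_inverse_le) auto
    then show ?thesis using True by (simp add: field_simps)
  next
    case False
    then have "n = 0 \<or> n = 1" by auto
    then show ?thesis using assms by (auto simp: power_0_left)
  qed
  have "zt k \<le> pi\<^sup>2 / 6 / 2 + 1 / 2"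
    by (rule sums_le[OF le zt_sums bound]) (use assms in simp)
  moreover have "pi ^ 2 < 4 ^ 2"
    by (intro power_strict_mono pi_less_4) auto
  ultimately show ?thesis by simp
qed

lemma zt_pos: "k > 1 \<Longrightarrow> zt k > 0"
  by (rule suminf_pos2[of _ 1]) (auto intro: inverse_power_summable)

lemma hz_antimono:
  assumes "k > 1" "0 < x" "x \<le> y"
  shows "hz k y \<le> hz k x"
  using assms by (intro sums_le[OF _ hz_sums hz_sums] divide_left_mono power_mono mult_pos_pos zero_less_power) auto

lemma hz_nonneg: "k > 1 \<Longrightarrow> 0 < x \<Longrightarrow> 0 \<le> hz k x"
  by (rule sums_le[OF _ sums_zero hz_sums]) auto

text \<open>Divided by \<open>q ^ k\<close>, the left side is part of the series \<open>zt k\<close>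
  without its term 1, hence below 1. The first term of the right side alone is
  \<open>q ^ k\<close>.\<close>

lemma hz_dominant:
  assumes "k \<ge> 3" "q > 2"
  shows "(\<Sum>s\<in>{2..<q}. hz k (real s / real q)) < hz k (1 / real q)"
proof -
  let ?f = "\<lambda>n. if n mod q \<in> {2..<q} then inverse (real n ^ k) else 0"
  have "?f sums ((\<Sum>s\<in>{2..<q}. hz k (real s / real q)) / real q ^ k)"
    using assms by (intro hz_sum_residues) auto
  moreover have "(\<lambda>n. inverse (real n ^ k) - (if n = 1 then 1 else 0)) sums (zt k - 1)"
    using assms by (intro sums_diff zt_sums sums_single[of 1 "\<lambda>_. 1"]) auto
  moreover have "?f n \<le> inverse (real n ^ k) - (if n = 1 then 1 else 0)" for n
    using assms by auto
  ultimately have "(\<Sum>s\<in>{2..<q}. hz k (real s / real q)) / real q ^ k \<le> zt k - 1"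
    by (rule sums_le[rotated])
  also have "\<dots> < 1" using zt_less_2[OF assms(1)] by simp
  finally have "(\<Sum>s\<in>{2..<q}. hz k (real s / real q)) < real q ^ k"
    using assms(2) by (simp add: divide_simps)
  also have "\<dots> \<le> hz k (1 / real q)"
  proof -
    have "(\<lambda>n. if n = 0 then real q ^ k else 0) sums (real q ^ k)"
      using sums_single[of 0 "\<lambda>_. real q ^ k"] by simp
    moreover have "(\<lambda>n. 1 / (real n + 1 / real q) ^ k) sums hz k (1 / real q)"
      using assms by (intro hz_sums) auto
    ultimately show ?thesis
      by (rule sums_le[rotated]) (use assms in \<open>auto simp: power_divide\<close>)
  qed
  finally show ?thesis .
qed

text \<open>Sieving one prime at a time: among the surviving terms, the multiples of
  \<open>p\<close> contribute \<open>1 / p ^ k\<close> times the whole sum.\<close>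

lemma zt_euler_factors:
  assumes "k > 1" "finite P" "\<And>p. p \<in> P \<Longrightarrow> prime p"
  shows "(\<lambda>n. if \<forall>p\<in>P. \<not> p dvd n then inverse (real n ^ k) else 0) sums
    (zt k * (\<Prod>p\<in>P. 1 - 1 / real p ^ k))"
  using assms(2,3)
proof (induction P rule: finite_induct)
  case empty
  then show ?case using zt_sums[OF assms(1)] by simp
next
  case (insert p P)
  let ?f = "\<lambda>n. if \<forall>p\<in>P. \<not> p dvd n then inverse (real n ^ k) else 0"
  let ?S = "zt k * (\<Prod>p\<in>P. 1 - 1 / real p ^ k)"
  let ?h = "\<lambda>n. if p dvd n then ?f n else 0"
  have p: "prime p" "p > 0" using insert.prems prime_gt_0_nat by auto
  have f: "?f sums ?S" using insert by blast
  have "?f m * (1 / real p ^ k) = ?h (p * m)" for m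
  proof -
    \<comment> \<open>A prime in \<open>P\<close> differs from \<open>p\<close>, so the factor
      \<open>p\<close> does not affect divisibility by it.\<close>
    have "p' dvd p * m \<longleftrightarrow> p' dvd m" if "p' \<in> P" for p'
      using that insert p(1) by (metis insertCI prime_dvd_mult_iff primes_dvd_imp_eq)
    then show ?thesis by (auto simp: power_mult_distrib divide_inverse)
  qed
  then have "(\<lambda>m. ?h (p * m)) sums (?S * (1 / real p ^ k))"
    using sums_mult2[OF f, of "1 / real p ^ k"] by simp
  then have "?h sums (?S * (1 / real p ^ k))"
    using p(2) by (subst (asm) sums_mono_reindex) (auto simp: strict_mono_def elim!: dvdE)
  from sums_diff[OF f this]
  have "(\<lambda>n. ?f n - ?h n) sums (?S * (1 - 1 / real p ^ k))"
    by (simp add: algebra_simps)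
  also have "(\<lambda>n. ?f n - ?h n) = (\<lambda>n. if \<forall>p\<in>insert p P. \<not> p dvd n then inverse (real n ^ k) else 0)"
    by auto
  finally show ?case using insert by (simp add: mult_ac)
qed

lemma coprime_iff_prime_factors:
  fixes n q :: nat
  assumes "q > 0"
  shows "coprime n q \<longleftrightarrow> (\<forall>p\<in>prime_factors q. \<not> p dvd n)"
proof
  assume "coprime n q"
  then show "\<forall>p\<in>prime_factors q. \<not> p dvd n"
    by (metis coprime_common_divisor in_prime_factors_iff not_prime_unit)
next
  assume *: "\<forall>p\<in>prime_factors q. \<not> p dvd n"
  show "coprime n q"
  proof (rule ccontr)
    assume "\<not> coprime n q"
    then have "gcd n q \<noteq> 1" by (simp add: coprime_iff_gcd_eq_1)
    then obtain p where "prime p" "p dvd gcd n q" using prime_factor_nat by blast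
    with * assms show False by (auto simp: in_prime_factors_iff)
  qed
qed

text \<open>The sum of \<open>n ^ (-k)\<close> over \<open>n\<close> coprime to \<open>q\<close> is
  computed by residue classes and by Euler factors; the product \<open>E\<close> of these factors is
  rational and nonzero.\<close>

lemma zt_in_chowla_milnor_space:
  assumes "k > 1" "q > 1"
  shows "zt k \<in> chowla_milnor_space k q"
proof -
  define A where "A = {a. 1 \<le> a \<and> a < q \<and> coprime a q}"
  define E where "E = (\<Prod>p\<in>prime_factors q. 1 - 1 / real p ^ k)"
  have "n mod q \<in> A \<longleftrightarrow> (\<forall>p\<in>prime_factors q. \<not> p dvd n)" for n
  proof -
    have "n mod q \<in> A \<longleftrightarrow> coprime n q"
      using assms(2) by (auto simp: A_def Suc_le_eq intro!: gr0I)
    then show ?thesis using coprime_iff_prime_factors assms(2) by simp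
  qed
  then have "(\<lambda>n. if \<forall>p\<in>prime_factors q. \<not> p dvd n then inverse (real n ^ k) else 0) sums
      ((\<Sum>a\<in>A. hz k (real a / real q)) / real q ^ k)"
    using hz_sum_residues[of k q A] assms by (simp add: A_def subset_iff)
  moreover have "(\<lambda>n. if \<forall>p\<in>prime_factors q. \<not> p dvd n then inverse (real n ^ k) else 0) sums (zt k * E)"
    unfolding E_def using assms(1) by (intro zt_euler_factors) auto
  ultimately have eq: "zt k * E = (\<Sum>a\<in>A. hz k (real a / real q)) / real q ^ k"
    by (rule sums_unique2[symmetric])
  have "E \<noteq> 0"
  proof -
    have "1 - 1 / real p ^ k > 0" if "p \<in> prime_factors q" for p
    proof -
      have "p > 1" using that prime_gt_1_nat by auto
      then show ?thesis using assms(1) by (simp add: one_less_power)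
    qed
    then have "E > 0" unfolding E_def by (intro prod_pos) blast
    then show ?thesis by simp
  qed
  have "1 / (E * real q ^ k) \<in> \<rat>" unfolding E_def by (intro Rats_divide Rats_mult Rats_prod) auto
  then obtain c where c: "1 / (E * real q ^ k) = of_rat c" by (elim Rats_cases)
  have "zt k = of_rat c * (\<Sum>a\<in>A. hz k (real a / real q))"
    unfolding c[symmetric] using eq \<open>E \<noteq> 0\<close> assms(2) by (simp add: field_simps)
  also have "\<dots> \<in> chowla_milnor_space k q"
    unfolding chowla_milnor_space_def A_def
    by (intro rat_real.span_scale rat_real.span_sum rat_real.span_base) blast
  finally show ?thesis .
qed

section \<open>Dimension of the Chowla--Milnor spaces\<close>

text \<open>One rational polynomial serves all \<open>a\<close>; this is what allows a relation
  between the differences to be conjugated.\<close>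

lemma hz_difference_cyclotomic:
  assumes "k > 1" "odd k" "q > 0"
  obtains H where "rat_coeffs H"
    "\<And>a. 0 < a \<Longrightarrow> a < q \<Longrightarrow> complex_of_real (hz k (real a / real q) - hz k (1 - real a / real q)) =
       (of_real pi * \<i>) ^ k * poly H (cis (2 * pi / real q) ^ a)"
proof -
  \<comment> \<open>At every \<open>q\<close>-th root of unity other than 1, \<open>V\<close> takes
    the value \<open>1 + 2 / (w - 1) = (w + 1) / (w - 1)\<close>, that is, \<open>-i\<close> times a
    cotangent.\<close>
  define V where "V = 1 + Polynomial.smult (2 / of_nat q) (\<Sum>j<q. Polynomial.monom (of_nat j :: complex) j)"
  define H where "H = Polynomial.smult (1 / fact (k - 1)) (reflection_poly (k - 1) \<circ>\<^sub>p V)"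
  have "rat_coeffs (reflection_poly m)" for m
    by (induction m) (auto intro!: rat_coeffs_mult rat_coeffs_pderiv simp del: mult_pCons_left)
  moreover have "rat_coeffs V"
    unfolding V_def one_pCons
    by (intro rat_coeffs_add rat_coeffs_smult rat_coeffs_sum rat_coeffs_monom) auto
  moreover have "(1 / fact (k - 1) :: complex) \<in> \<rat>"
    by (metis Rats_1 Rats_divide Rats_of_nat of_nat_fact)
  ultimately have "rat_coeffs H"
    unfolding H_def by (intro rat_coeffs_smult rat_coeffs_pcompose)
  moreover have "complex_of_real (hz k (real a / real q) - hz k (1 - real a / real q)) =
       (of_real pi * \<i>) ^ k * poly H (cis (2 * pi / real q) ^ a)" if a: "0 < a" "a < q" for a
  proof -
    define t where "t = pi * (real a / real q)"
    define w where "w = cis (2 * t)"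
    have w: "w = cis (2 * pi / real q) ^ a"
      by (simp add: w_def t_def Complex.DeMoivre mult_ac)
    have "sin t > 0"
      using a by (intro sin_gt_zero) (auto simp: t_def field_simps)
    then have y: "- \<i> * cot (complex_of_real t) = (w + 1) / (w - 1)"
      unfolding w_def by (intro cot_conv_cis) auto
    have wq: "w ^ q = 1"
    proof -
      have "w ^ q = cis (2 * pi * real a)"
        using a by (simp add: w_def t_def Complex.DeMoivre mult.assoc)
      then show ?thesis by (simp only: cis_multiple_2pi[OF Ints_of_nat])
    qed
    have w1: "w \<noteq> 1"
    proof
      assume "w = 1"
      then have "cos (2 * t) = 1" by (simp add: w_def complex_eq_iff)
      then have "2 * (sin t)\<^sup>2 = 0" by (simp add: cos_double_sin)
      with \<open>sin t > 0\<close> show False by simp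
    qed
    have "poly V w = 1 + 2 / of_nat q * (\<Sum>j<q. of_nat j * w ^ j)"
      by (simp add: V_def poly_sum poly_monom)
    also have "\<dots> = (w + 1) / (w - 1)"
      unfolding inverse_root_of_unity_minus_one[OF wq w1 assms(3)]
      using w1 assms(3) by (simp add: field_simps)
    finally have "poly H w = poly (reflection_poly (k - 1)) (- \<i> * cot (complex_of_real t)) / fact (k - 1)"
      unfolding H_def y by (simp add: poly_pcompose)
    then show ?thesis
      unfolding w[symmetric] using hz_reflection[OF assms(1,2), of "real a / real q"] a
      by (simp add: t_def)
  qed
  ultimately show thesis using that by blast
qed

section \<open>Linear independence of the differences\<close>

lemma of_real_of_rat: "of_real (of_rat c) = (of_rat c :: complex)"
  by (cases c) (simp add: of_rat_rat)

text \<open>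
  Choose a coefficient \<open>c d\<close> of maximal absolute value and conjugate the relation so that
  \<open>d\<close> is moved to 1. The term of the residue 1 then exceeds the sum of all the others.
\<close>
lemma hz_differences_independent:
  fixes c :: "nat \<Rightarrow> rat"
  assumes "k > 1" "odd k" "q > 2"
    and A_def: "A = {a. 1 \<le> a \<and> 2 * a < q \<and> coprime a q}"
    and rel: "(\<Sum>a\<in>A. of_rat (c a) * (hz k (real a / real q) - hz k (1 - real a / real q))) = 0"
    and "a \<in> A"
  shows "c a = 0"
proof -
  define g where "g a = hz k (real a / real q) - hz k (1 - real a / real q)" for a
  define w where "w = cis (2 * pi / real q)"
  have k3: "k \<ge> 3" using assms(1,2) by (cases "k = 2") auto
  have fin: "finite A" unfolding A_def by (rule finite_subset[of _ "{..<q}"]) auto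
  obtain H where H: "rat_coeffs H"
    "\<And>a. 0 < a \<Longrightarrow> a < q \<Longrightarrow> complex_of_real (g a) = (of_real pi * \<i>) ^ k * poly H (w ^ a)"
    using hz_difference_cyclotomic[OF assms(1,2), of q] assms(3) unfolding g_def w_def by auto
  have wq: "w ^ q = 1"
    using assms(3) by (simp add: w_def Complex.DeMoivre)
  note wmod = power_mod_root_of_unity[OF wq]
  define x where "x = Max ((\<lambda>a. \<bar>c a\<bar>) ` A)"
  have "x \<in> (\<lambda>a. \<bar>c a\<bar>) ` A"
    unfolding x_def using fin \<open>a \<in> A\<close> by (intro Max_in) auto
  then obtain d where d: "d \<in> A" "x = \<bar>c d\<bar>" by blast
  have cmax: "\<bar>c a\<bar> \<le> \<bar>c d\<bar>" if "a \<in> A" for a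
    using fin that unfolding d(2)[symmetric] x_def by (intro Max_ge) auto
  have "coprime d q" using d(1) by (simp add: A_def)
  \<comment> \<open>Raising \<open>w\<close> to the inverse \<open>b\<close> of \<open>d\<close>
    modulo \<open>q\<close> is the conjugation that moves \<open>d\<close> to 1.\<close>
  then obtain b where b: "[d * b = 1] (mod q)"
    using cong_solve_coprime_nat[of d q] by auto
  then have cop: "coprime b q"
    using coprime_iff_invertible_nat[of b q] by (auto simp: mult.commute)
  define T where "T a = a * b mod q" for a
  have T: "0 < T a" "T a < q" if "a \<in> A" for a
  proof -
    have "coprime (a * b) q" using that cop by (simp add: A_def)
    then have "\<not> q dvd a * b"
      using coprime_common_divisor[of "a * b" q q] assms(3) by auto
    then show "0 < T a" unfolding T_def by (simp add: mod_greater_zero_iff_not_dvd)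
    show "T a < q" using assms(3) by (simp add: T_def)
  qed
  have Td: "T d = 1" using b assms(3) by (simp add: T_def cong_def)
  have cong_cancel: "[a * b = a' * b] (mod q) \<longleftrightarrow> [a = a'] (mod q)" for a a'
    using cop by (simp add: cong_mult_rcancel_nat)
  have T_inj: "a = a'" if "a \<in> A" "a' \<in> A" "T a = T a'" for a a'
    using that cong_cancel[of a a'] by (simp add: T_def cong_def A_def)
  \<comment> \<open>Multiplication by the unit \<open>b\<close> creates no opposite residues: two
    elements of \<open>A\<close> have a sum strictly between 0 and \<open>q\<close>.\<close>
  have T_neg: "T a + T a' \<noteq> q" if "a \<in> A" "a' \<in> A" for a a'
  proof
    assume "T a + T a' = q"
    then have "(a * b + a' * b) mod q = 0"
      unfolding T_def by (metis mod_add_eq mod_self)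
    then have "q dvd b * (a + a')" by (simp add: algebra_simps dvd_eq_mod_eq_0)
    then have "q dvd a + a'"
      using cop by (simp add: coprime_dvd_mult_right_iff coprime_commute)
    then show False using that dvd_imp_le[of q "a + a'"] by (auto simp: A_def)
  qed
  have conj: "(\<Sum>a\<in>A. of_rat (c a) * g (T a)) = 0"
  proof -
    define P where "P = (\<Sum>a\<in>A. Polynomial.smult (of_rat (c a)) (H \<circ>\<^sub>p Polynomial.monom 1 a))"
    have P: "poly P u = (\<Sum>a\<in>A. of_rat (c a) * poly H (u ^ a))" for u
      by (simp add: P_def poly_sum poly_pcompose poly_monom)
    have "rat_coeffs P"
      unfolding P_def using H(1)
      by (intro rat_coeffs_sum rat_coeffs_smult rat_coeffs_pcompose rat_coeffs_monom) auto
    have "(of_real pi * \<i>) ^ k * poly P w = (\<Sum>a\<in>A. of_rat (c a) * complex_of_real (g a))"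
      unfolding P sum_distrib_left by (intro sum.cong) (auto simp: H(2) A_def)
    also have "\<dots> = of_real (\<Sum>a\<in>A. of_rat (c a) * g a)" by (simp add: of_real_of_rat)
    also have "\<dots> = 0" using rel by (simp add: g_def)
    finally have "poly P w = 0" by simp
    then have "poly P (w ^ b) = 0"
      using rat_poly_zero_power_coprime[OF \<open>rat_coeffs P\<close> wq _ cop] assms(3) by simp
    have "complex_of_real (\<Sum>a\<in>A. of_rat (c a) * g (T a)) = (\<Sum>a\<in>A. of_rat (c a) * complex_of_real (g (T a)))"
      by (simp add: of_real_of_rat)
    also have "\<dots> = (of_real pi * \<i>) ^ k * poly P (w ^ b)"
      unfolding P sum_distrib_left
      by (intro sum.cong) (auto simp: H(2) T, simp add: T_def wmod power_mult[symmetric] mult.commute)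
    finally show ?thesis using \<open>poly P (w ^ b) = 0\<close> by (simp only: mult_zero_right of_real_eq_0_iff)
  qed
  \<comment> \<open>The residue \<open>T a\<close> up to sign, represented in the lower
    half.\<close>
  define s where "s a = min (T a) (q - T a)" for a
  \<comment> \<open>A difference of two nonnegative numbers is bounded by the larger one, and
    \<open>hz k\<close> is larger at the smaller argument.\<close>
  have g_bound: "\<bar>g t\<bar> \<le> hz k (real (min t (q - t)) / real q)" if t: "0 < t" "t < q" for t
  proof -
    have eq: "1 - real t / real q = real (q - t) / real q" using t by (simp add: field_simps)
    have "hz k (real t / real q) \<ge> 0" "hz k (real (q - t) / real q) \<ge> 0"
      using t assms(1) by (auto intro!: hz_nonneg)
    moreover have "hz k (real (max t (q - t)) / real q) \<le> hz k (real (min t (q - t)) / real q)"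
      using t assms(1) by (intro hz_antimono) (auto simp: divide_right_mono)
    ultimately show ?thesis unfolding g_def eq
      by (cases "t \<le> q - t") (auto simp: min_def max_def)
  qed
  have s_inj: "inj_on s (A - {d})"
  proof (rule inj_onI)
    fix a a' assume *: "a \<in> A - {d}" "a' \<in> A - {d}" "s a = s a'"
    then have "T a = T a' \<or> T a + T a' = q"
      using T[of a] T[of a'] by (auto simp: s_def min_def split: if_splits)
    then show "a = a'" using T_inj T_neg * by blast
  qed
  \<comment> \<open>The value 1 belongs to \<open>d\<close> alone. Leaving out \<open>q - 1\<close>
    as well reserves that residue for the negative part of \<open>g 1\<close>.\<close>
  have s_range: "s ` (A - {d}) \<subseteq> {2..<q - 1}"
  proof
    fix y assume "y \<in> s ` (A - {d})"
    then obtain a where a: "a \<in> A" "a \<noteq> d" "y = s a" by blast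
    have "T a \<noteq> 1" "T a \<noteq> q - 1"
      using T_inj[OF a(1) d(1)] T_neg[OF a(1) d(1)] a(2) Td assms(3) by auto
    then show "y \<in> {2..<q - 1}"
      using T[OF a(1)] a(3) assms(3) by (auto simp: s_def min_def)
  qed
  have abs_of_rat: "\<bar>of_rat y\<bar> = (of_rat \<bar>y\<bar> :: real)" for y :: rat
    by (simp add: abs_if of_rat_minus)
  have hzs: "hz k (real y / real q) \<ge> 0" if "y \<in> {2..<q}" for y
    using that assms(1) by (intro hz_nonneg) auto
  have "\<bar>of_rat (c d)\<bar> * g 1 \<le> \<bar>of_rat (c d) * g (T d)\<bar>"
    unfolding Td abs_mult by (intro mult_left_mono) auto
  also have "of_rat (c d) * g (T d) = - (\<Sum>a\<in>A - {d}. of_rat (c a) * g (T a))"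
    using conj sum.remove[OF fin d(1), of "\<lambda>a. of_rat (c a) * g (T a)"] by simp
  also have "\<bar>- (\<Sum>a\<in>A - {d}. of_rat (c a) * g (T a))\<bar> \<le> (\<Sum>a\<in>A - {d}. \<bar>of_rat (c a) * g (T a)\<bar>)"
    unfolding abs_minus_cancel by (rule sum_abs)
  also have "\<dots> \<le> (\<Sum>a\<in>A - {d}. \<bar>of_rat (c d)\<bar> * hz k (real (s a) / real q))"
  proof (rule sum_mono)
    fix a assume "a \<in> A - {d}"
    then have "a \<in> A" by simp
    have "\<bar>of_rat (c a) :: real\<bar> \<le> \<bar>of_rat (c d)\<bar>"
      using cmax[OF \<open>a \<in> A\<close>] by (simp add: abs_of_rat of_rat_less_eq)
    then show "\<bar>of_rat (c a) * g (T a)\<bar> \<le> \<bar>of_rat (c d)\<bar> * hz k (real (s a) / real q)"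
      unfolding abs_mult s_def using g_bound T[OF \<open>a \<in> A\<close>] by (intro mult_mono) auto
  qed
  also have "\<dots> = \<bar>of_rat (c d)\<bar> * (\<Sum>y\<in>s ` (A - {d}). hz k (real y / real q))"
    by (simp add: sum.reindex[OF s_inj] sum_distrib_left)
  also have "\<dots> \<le> \<bar>of_rat (c d)\<bar> * (\<Sum>y\<in>{2..<q - 1}. hz k (real y / real q))"
    using s_range hzs by (intro mult_left_mono sum_mono2) auto
  finally have le: "\<bar>of_rat (c d)\<bar> * g 1 \<le> \<bar>of_rat (c d)\<bar> * (\<Sum>y\<in>{2..<q - 1}. hz k (real y / real q))" .
  \<comment> \<open>The residue \<open>q - 1\<close> pays for the term at \<open>1 - 1 / q\<close>
    that is subtracted in \<open>g 1\<close>.\<close>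
  have "{2..<q} = insert (q - 1) {2..<q - 1}" using assms(3) by auto
  then have "(\<Sum>y\<in>{2..<q - 1}. hz k (real y / real q)) + hz k (real (q - 1) / real q) < hz k (1 / real q)"
    using hz_dominant[OF k3 assms(3)] by simp
  moreover have "real (q - 1) / real q = 1 - 1 / real q"
    using assms(3) by (simp add: field_simps)
  ultimately have lt: "(\<Sum>y\<in>{2..<q - 1}. hz k (real y / real q)) < g 1"
    by (simp add: g_def)
  have "c d = 0"
  proof (rule ccontr)
    assume "c d \<noteq> 0"
    then have "\<bar>of_rat (c d)\<bar> * (\<Sum>y\<in>{2..<q - 1}. hz k (real y / real q)) < \<bar>of_rat (c d)\<bar> * g 1"
      using lt by (intro mult_strict_left_mono) auto
    with le show False by simp
  qed
  then show ?thesis using cmax[OF \<open>a \<in> A\<close>] by simp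
qed

section \<open>Counting units below half the modulus\<close>

lemma coprime_diff_nat_iff:
  fixes a q :: nat
  assumes "a \<le> q"
  shows "coprime (q - a) q \<longleftrightarrow> coprime a q"
proof -
  have "gcd (q - a) q = gcd a q"
    using gcd_add2[of "q - a" a] gcd_add2[of a "q - a"] assms by (simp add: gcd.commute)
  then show ?thesis by (simp add: coprime_iff_gcd_eq_1)
qed

text \<open>The map from \<open>a\<close> to \<open>q - a\<close> pairs the units below
  \<open>q / 2\<close> with those above; for \<open>q > 2\<close> the midpoint is never coprime to
  \<open>q\<close>.\<close>

lemma card_coprime_below_half:
  assumes "q > 2"
  shows "2 * card {a. 1 \<le> a \<and> 2 * a < q \<and> coprime a q} = totient q"
proof -
  define A where "A = {a. 1 \<le> a \<and> 2 * a < q \<and> coprime a q}"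
  have fin: "finite A" unfolding A_def by (rule finite_subset[of _ "{..<q}"]) auto
  have half: "2 * a \<noteq> q" if "coprime a q" for a
  proof
    assume "2 * a = q"
    then have "a dvd q" by auto
    with that have "a = 1" by (metis coprime_absorb_left nat_dvd_1_iff_1)
    with \<open>2 * a = q\<close> assms show False by simp
  qed
  have "totatives q = A \<union> (\<lambda>a. q - a) ` A"
  proof (intro equalityI subsetI)
    fix a assume "a \<in> totatives q"
    then have a: "0 < a" "a \<le> q" "coprime a q" by (auto simp: totatives_def)
    have "a \<noteq> q" using a assms by auto
    have "2 * a < q \<or> 2 * (q - a) < q" using half[OF a(3)] a(2) by arith
    then consider "2 * a < q" | "2 * (q - a) < q" by blast
    then show "a \<in> A \<union> (\<lambda>a. q - a) ` A"
    proof cases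
      case 2
      then have "q - a \<in> A" using a \<open>a \<noteq> q\<close> by (auto simp: A_def coprime_diff_nat_iff)
      moreover have "a = q - (q - a)" using a by simp
      ultimately show ?thesis by blast
    qed (use a in \<open>auto simp: A_def\<close>)
  next
    fix a assume "a \<in> A \<union> (\<lambda>a. q - a) ` A"
    then show "a \<in> totatives q" by (auto simp: A_def totatives_def coprime_diff_nat_iff)
  qed
  moreover have "A \<inter> (\<lambda>a. q - a) ` A = {}" by (auto simp: A_def)
  moreover have "card ((\<lambda>a. q - a) ` A) = card A"
    by (intro card_image inj_onI) (auto simp: A_def)
  ultimately have "2 * card A = totient q"
    using fin by (simp add: totient_def card_Un_disjoint)
  then show ?thesis by (simp only: A_def)
qed

text \<open>The space contains \<open>totient q / 2\<close> independent differences and also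
  \<open>zt k\<close>. If \<open>zt k\<close> were outside their span, the dimension would reach the
  excluded value; so \<open>zt k\<close> is a rational combination of them.\<close>

lemma zt_cyclotomic_if_dim_small:
  assumes "k > 1" "odd k" "q > 2"
    and small: "\<not> real (rat_real.dim (chowla_milnor_space k q)) \<ge> real (totient q) / 2 + 1"
  obtains P where "rat_coeffs P"
    "complex_of_real (zt k) = (of_real pi * \<i>) ^ k * poly P (cis (2 * pi / real q))"
proof -
  define V where "V = chowla_milnor_space k q"
  define A where "A = {a. 1 \<le> a \<and> 2 * a < q \<and> coprime a q}"
  define g where "g a = hz k (real a / real q) - hz k (1 - real a / real q)" for a
  have fin: "finite A" unfolding A_def by (rule finite_subset[of _ "{..<q}"]) auto
  have indep: "\<forall>a\<in>A. c a = 0" if "(\<Sum>a\<in>A. of_rat (c a) * g a) = 0" for c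
    using hz_differences_independent[OF assms(1-3) A_def] that unfolding g_def by blast
  have inj: "inj_on g A"
  proof (rule inj_onI, rule ccontr)
    fix a a' assume *: "a \<in> A" "a' \<in> A" "g a = g a'" "a \<noteq> a'"
    define c :: "nat \<Rightarrow> rat" where "c = (\<lambda>x. if x = a then 1 else if x = a' then -1 else 0)"
    have "(\<Sum>x\<in>A. of_rat (c x) * g x) = (\<Sum>x\<in>{a, a'}. of_rat (c x) * g x)"
      using * fin by (intro sum.mono_neutral_right) (auto simp: c_def)
    also have "\<dots> = 0" using * by (simp add: c_def of_rat_minus)
    finally have "c a = 0" using indep * by blast
    then show False by (simp add: c_def)
  qed
  have ind: "rat_real.independent (g ` A)"
  proof (rule notI)
    assume "rat_real.dependent (g ` A)"
    then obtain u y where u: "y \<in> g ` A" "u y \<noteq> 0" "(\<Sum>v\<in>g ` A. of_rat (u v) * v) = 0"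
      using rat_real.dependent_finite[of "g ` A"] fin by auto
    then have "(\<Sum>a\<in>A. of_rat (u (g a)) * g a) = 0"
      by (simp add: sum.reindex[OF inj])
    with indep[of "\<lambda>a. u (g a)"] u show False by blast
  qed
  have base: "hz k (real x / real q) \<in> V" if "1 \<le> x" "x < q" "coprime x q" for x
    unfolding V_def chowla_milnor_space_def using that by (intro rat_real.span_base) blast
  have gV: "g a \<in> V" if "a \<in> A" for a
  proof -
    have "coprime (q - a) q"
      using that by (simp add: A_def coprime_diff_nat_iff)
    moreover have "1 - real a / real q = real (q - a) / real q"
      using that by (simp add: A_def field_simps of_nat_diff)
    ultimately show ?thesis
      using that base[of a] base[of "q - a"]
      unfolding V_def chowla_milnor_space_def g_def by (auto simp: A_def intro: rat_real.span_diff)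
  qed
  have "zt k \<in> rat_real.span (g ` A)"
  proof (rule ccontr)
    assume notin: "zt k \<notin> rat_real.span (g ` A)"
    define B where "B = insert (zt k) (g ` A)"
    have "rat_real.independent B"
      unfolding B_def using notin ind by (rule rat_real.independent_insertI)
    moreover have "B \<subseteq> V"
      using gV zt_in_chowla_milnor_space[of k q] assms by (auto simp: B_def V_def)
    moreover have "card B = card A + 1"
      using notin fin card_image[OF inj] rat_real.span_base unfolding B_def by (subst card_insert_disjoint) auto
    moreover obtain C where C: "C \<subseteq> V" "rat_real.independent C" "V \<subseteq> rat_real.span C" "card C = rat_real.dim V"
      by (rule rat_real.basis_exists)
    \<comment> \<open>An infinite set has \<open>card\<close> 0, so the dimension bounds independent
      sets only once the basis is known to be finite.\<close>
    moreover have "finite C"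
    proof -
      have "finite {hz k (real a / real q) | a. 1 \<le> a \<and> a < q \<and> coprime a q}"
        by (rule finite_subset[of _ "(\<lambda>a. hz k (real a / real q)) ` {..<q}"]) auto
      then show ?thesis
        using rat_real.independent_span_bound C(1,2) unfolding V_def chowla_milnor_space_def by blast
    qed
    ultimately have "card A + 1 \<le> rat_real.dim V"
      using rat_real.independent_span_bound[of C B] by auto
    moreover have "2 * card A = totient q"
      unfolding A_def by (rule card_coprime_below_half[OF assms(3)])
    then have "real (totient q) / 2 = real (card A)" by linarith
    ultimately show False using small unfolding V_def by simp
  qed
  then obtain u where u: "zt k = (\<Sum>v\<in>g ` A. of_rat (u v) * v)"
    using rat_real.span_finite[of "g ` A"] fin by auto
  define w where "w = cis (2 * pi / real q)"
  obtain H where H: "rat_coeffs H"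
    "\<And>a. 0 < a \<Longrightarrow> a < q \<Longrightarrow> complex_of_real (g a) = (of_real pi * \<i>) ^ k * poly H (w ^ a)"
    using hz_difference_cyclotomic[OF assms(1,2), of q] assms(3) unfolding g_def w_def by auto
  define P where "P = (\<Sum>a\<in>A. Polynomial.smult (of_rat (u (g a))) (H \<circ>\<^sub>p Polynomial.monom 1 a))"
  have "rat_coeffs P"
    unfolding P_def using H(1)
    by (intro rat_coeffs_sum rat_coeffs_smult rat_coeffs_pcompose rat_coeffs_monom) auto
  moreover have "complex_of_real (zt k) = (of_real pi * \<i>) ^ k * poly P w"
  proof -
    have "complex_of_real (zt k) = (\<Sum>a\<in>A. of_rat (u (g a)) * complex_of_real (g a))"
      unfolding u by (simp add: sum.reindex[OF inj] of_real_of_rat)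
    also have "\<dots> = (of_real pi * \<i>) ^ k * poly P w"
      unfolding P_def poly_sum sum_distrib_left
      by (intro sum.cong) (auto simp: H(2) A_def poly_pcompose poly_monom)
    finally show ?thesis .
  qed
  ultimately show thesis using that unfolding w_def by blast
qed

theorem mainTheorem1:
  fixes k q r :: nat
  assumes "k > 1" and "odd k"
    and "q > 2" and "r > 2" and "coprime q r"
  shows "real (rat_real.dim (chowla_milnor_space k q)) \<ge> real (totient q) / 2 + 1 \<or>
         real (rat_real.dim (chowla_milnor_space k r)) \<ge> real (totient r) / 2 + 1"
proof (rule ccontr)
  assume "\<not> ?thesis"
  then have small: "\<not> real (rat_real.dim (chowla_milnor_space k q)) \<ge> real (totient q) / 2 + 1"
    "\<not> real (rat_real.dim (chowla_milnor_space k r)) \<ge> real (totient r) / 2 + 1" by auto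
  define z where "z = complex_of_real (zt k) / (of_real pi * \<i>) ^ k"
  \<comment> \<open>A primitive root of order \<open>q * r\<close> carries both fields:
    \<open>w ^ r\<close> and \<open>w ^ q\<close> are primitive of orders \<open>q\<close> and
    \<open>r\<close>.\<close>
  define w where "w = cis (2 * pi / real (q * r))"
  obtain P where P: "rat_coeffs P" "z = poly P (w ^ r)"
  proof -
    have "w ^ r = cis (2 * pi / real q)"
      using assms(4) by (simp add: w_def Complex.DeMoivre)
    moreover obtain P where "rat_coeffs P"
      "complex_of_real (zt k) = (of_real pi * \<i>) ^ k * poly P (cis (2 * pi / real q))"
      by (rule zt_cyclotomic_if_dim_small[OF assms(1-3) small(1)])
    ultimately show thesis by (intro that[of P]) (simp_all add: z_def)
  qed
  obtain R where R: "rat_coeffs R" "z = poly R (w ^ q)"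
  proof -
    have "w ^ q = cis (2 * pi / real r)"
      using assms(3) by (simp add: w_def Complex.DeMoivre)
    moreover obtain R where "rat_coeffs R"
      "complex_of_real (zt k) = (of_real pi * \<i>) ^ k * poly R (cis (2 * pi / real r))"
      by (rule zt_cyclotomic_if_dim_small[OF assms(1,2,4) small(2)])
    ultimately show thesis by (intro that[of R]) (simp_all add: z_def)
  qed
  have wqr: "w ^ (q * r) = 1"
    using assms(3,4) by (simp add: w_def Complex.DeMoivre)
  \<comment> \<open>This conjugation acts as complex conjugation on the q-th roots of unity and fixes the r-th ones.\<close>
  obtain b where b: "[b = q - 1] (mod q)" "[b = 1] (mod r)"
    using binary_chinese_remainder_nat[OF assms(5)] by blast
  have "coprime b q"
    using cong_imp_coprime[OF cong_sym[OF b(1)]] assms(3) coprime_diff_one_left_nat[of q] by simp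
  moreover have "coprime b r"
    using cong_imp_coprime[OF cong_sym[OF b(2)]] by simp
  ultimately have cop: "coprime b (q * r)" by simp
  \<comment> \<open>The equality of the two representations of \<open>z\<close> becomes one rational
    relation in \<open>w\<close>, which can be conjugated.\<close>
  define D where "D = P \<circ>\<^sub>p Polynomial.monom 1 r - R \<circ>\<^sub>p Polynomial.monom 1 q"
  have D: "poly D u = poly P (u ^ r) - poly R (u ^ q)" for u
    by (simp add: D_def poly_pcompose poly_monom)
  have "rat_coeffs D"
    unfolding D_def using P(1) R(1)
    by (intro rat_coeffs_diff rat_coeffs_pcompose rat_coeffs_monom) auto
  moreover have "poly D w = 0" using D P(2) R(2) by simp
  ultimately have "poly D (w ^ b) = 0"
    using rat_poly_zero_power_coprime[OF _ wqr _ cop] assms(3,4) by simp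
  then have eq: "poly P ((w ^ r) ^ b) = poly R ((w ^ q) ^ b)"
    by (simp add: D power_mult[symmetric] mult.commute)
  have "(w ^ q) ^ b = w ^ q"
    using power_cong_root_of_unity[OF _ b(2), of "w ^ q"] wqr by (simp add: power_mult[symmetric])
  moreover have "(w ^ r) ^ b = cnj (w ^ r)"
  proof -
    have "(w ^ r) ^ b = (w ^ r) ^ (q - 1)"
      using power_cong_root_of_unity[OF _ b(1), of "w ^ r"] wqr by (simp add: power_mult[symmetric] mult.commute)
    moreover have "(w ^ r) ^ (q - 1) * w ^ r = 1"
      using wqr assms(3) by (metis power_minus_mult power_mult mult.commute not_gr_zero not_less_zero)
    moreover have "cnj (w ^ r) * w ^ r = 1"
      by (simp add: w_def cis_cnj cis_mult flip: power_mult_distrib)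
    ultimately show ?thesis
      by (metis mult_cancel_right mult_zero_right zero_neq_one)
  qed
  moreover have "poly P (cnj (w ^ r)) = cnj (poly P (w ^ r))"
  proof -
    have "poly.coeff P i \<in> \<real>" for i
      using P(1) unfolding rat_coeffs_def by (metis Rats_cases of_real_of_rat Reals_of_real)
    then show ?thesis by (simp add: poly_cnj_real)
  qed
  ultimately have "cnj z = z" using eq P(2) R(2) by simp
  \<comment> \<open>As \<open>k\<close> is odd, \<open>(pi * i) ^ k\<close> is purely imaginary,
    while \<open>zt k\<close> is real.\<close>
  moreover have "cnj z = - z"
    using assms(2) by (simp add: z_def power_mult_distrib)
  ultimately have "z = 0" by simp
  then show False using zt_pos[OF assms(1)] by (simp add: z_def)
qed

end
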